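(* Let $M$ be a monoid endowed with a total order $\le$. Let $\equiv$ be the equivalence relation on $\mathbf{P}(M)$ with $\mathfrak{p}\equiv\mathfrak{p}'$ iff $\mathfrak{p},\mathfrak{p}'$ have the same arity, $\mathrm{first}_1(\mathfrak{p})=\mathrm{first}_1(\mathfrak{p}')$, $\mathfrak{p}'$ is a rearrangement of the letters of $\mathfrak{p}$, and $\mathrm{first}_1^R(\mathfrak{p})=\mathrm{first}_1^R(\mathfrak{p}')$. Then $\mathbb{P}_\equiv:=\downarrow_3\circ\downarrow_2\circ\downarrow_1$ is a $\mathbb{P}$-symbol for $\equiv$ and $\mathbb{P}_\equiv(\mathbf{P}(M))$ is the set of $M$-pigmented pillars. Moreover, the graded set $\mathsf{Pill}_{1,1}(M):=\mathbf{P}(M)/_\equiv$ is isomorphic to the graded set of $M$-pigmented pillars.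
   Context: Let $(M,\cdot,e)$ be a monoid. An $M$-pigmented letter is a pair $i^\alpha$ with $i\ge1$ an integer (value) and $\alpha\in M$ (pigment); $\mathbf{P}(M)(n)$ is the set of words of $M$-pigmented letters with values in $[n]$. In a word, a position $j$ is a left (resp. right) $1$-witness if no earlier (resp. later) letter has the same value as the letter at $j$; $\mathrm{first}_1(\mathfrak{p})$ (resp. $\mathrm{first}_1^R(\mathfrak{p})$) is the subword of letters at left (resp. right) $1$-witness positions. Relations on $\mathbf{P}(M)$ (statuses computed in the left-hand word; $\mathfrak{p},\mathfrak{p}',\mathfrak{q}$ words): (1) $\mathfrak{p}\,i^{\alpha_1}\,\mathfrak{q}\,i^{\alpha_2}\,\mathfrak{p}'\leadsto_1\mathfrak{p}\,i^{\alpha_1}i^{\alpha_2}\,\mathfrak{q}\,\mathfrak{p}'$ when $\mathfrak{q}\neq\epsilon$, $\mathfrak{q}$ contains no letter of value $i$, the displayed position of $i^{\alpha_1}$ is not a right $1$-witness, and the displayed position of $i^{\alpha_2}$ is neither a left nor a right $1$-witness; (2) $\mathfrak{p}\,i^{\alpha_1}i^{\alpha_2}\,\mathfrak{p}'\leadsto_2\mathfrak{p}\,i^{\alpha_2}i^{\alpha_1}\,\mathfrak{p}'$ when both displayed positions are neither left nor right $1$-witnesses, $\alpha_1\ne\alpha_2$ and $\alpha_2\le\alpha_1$; (3) $\mathfrak{p}\,i_1^{\alpha_1}i_2^{\alpha_2}\,\mathfrak{p}'\leadsto_3\mathfrak{p}\,i_2^{\alpha_2}i_1^{\alpha_1}\,\mathfrak{p}'$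 when $i_1\ne i_2$, the position of $i_1^{\alpha_1}$ is not a right $1$-witness, and the position of $i_2^{\alpha_2}$ is not a left $1$-witness but is a right $1$-witness. Let $\preccurlyeq_j$ be the reflexive transitive closure of $\leadsto_j$; it is a partial order and each $\mathfrak{p}$ lies below exactly one maximal element, denoted $\downarrow_j(\mathfrak{p})$. An $M$-pigmented pillar of arity $n$ is an element of $\mathbf{P}(M)(n)$ maximal simultaneously for $\preccurlyeq_1,\preccurlyeq_2,\preccurlyeq_3$. A $\mathbb{P}$-symbol for an equivalence relation $\equiv$ on $\mathbf{P}(M)$ is a map $\mathbb{P}:\mathbf{P}(M)\to\mathbf{P}(M)$ such that $\mathfrak{p}\equiv\mathbb{P}(\mathfrak{p})$ for all $\mathfrak{p}$, and $\mathfrak{p}\equiv\mathfrak{p}'$ implies $\mathbb{P}(\mathfrak{p})=\mathbb{P}(\mathfrak{p}')$. *)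

theory Defs
  imports Main "HOL-Library.Multiset" "HOL-Library.FuncSet"
begin

text \<open>A pigmented letter is a pair of a value and a pigment. An element of the graded set
  \<open>P(M)\<close> carries its arity, so that one word may occur in several arities.
  The monoid \<open>M\<close> is the whole type of pigments.\<close>

type_synonym 'm letter = "nat \<times> 'm"
type_synonym 'm pword = "nat \<times> 'm letter list"

definition pwords :: "nat \<Rightarrow> 'm pword set" where
  "pwords n = {(n, w) |w. \<forall>x\<in>set w. 1 \<le> fst x \<and> fst x \<le> n}"

definition all_pwords :: "'m pword set" where
  "all_pwords = (\<Union>n. pwords n)"

text \<open>Positions are counted from \<open>0\<close>.\<close>

definition left_witness :: "'m letter list \<Rightarrow> nat \<Rightarrow> bool" where
  "left_witness w j \<longleftrightarrow> j < length w \<and> (\<forall>k<j. fst (w ! k) \<noteq> fst (w ! j))"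

definition right_witness :: "'m letter list \<Rightarrow> nat \<Rightarrow> bool" where
  "right_witness w j \<longleftrightarrow>
     j < length w \<and> (\<forall>k. j < k \<and> k < length w \<longrightarrow> fst (w ! k) \<noteq> fst (w ! j))"

definition first_left :: "'m letter list \<Rightarrow> 'm letter list" where
  "first_left w = nths w {j. left_witness w j}"

definition first_right :: "'m letter list \<Rightarrow> 'm letter list" where
  "first_right w = nths w {j. right_witness w j}"

inductive step1 :: "'m letter list \<Rightarrow> 'm letter list \<Rightarrow> bool" where
  "\<lbrakk> w = p @ [(i, a1)] @ q @ [(i, a2)] @ p';
     q \<noteq> [];
     \<forall>x\<in>set q. fst x \<noteq> i;
     \<not> right_witness w (length p);
     \<not> left_witness w (length p + 1 + length q);
     \<not> right_witness w (length p + 1 + length q) \<rbrakk>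
   \<Longrightarrow> step1 w (p @ [(i, a1), (i, a2)] @ q @ p')"

inductive step2 :: "('m::linorder) letter list \<Rightarrow> 'm letter list \<Rightarrow> bool" where
  "\<lbrakk> w = p @ [(i, a1), (i, a2)] @ p';
     \<not> left_witness w (length p); \<not> right_witness w (length p);
     \<not> left_witness w (length p + 1); \<not> right_witness w (length p + 1);
     a1 \<noteq> a2; a2 \<le> a1 \<rbrakk>
   \<Longrightarrow> step2 w (p @ [(i, a2), (i, a1)] @ p')"

inductive step3 :: "'m letter list \<Rightarrow> 'm letter list \<Rightarrow> bool" where
  "\<lbrakk> w = p @ [(i1, a1), (i2, a2)] @ p';
     i1 \<noteq> i2;
     \<not> right_witness w (length p);
     \<not> left_witness w (length p + 1);
     right_witness w (length p + 1) \<rbrakk>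
   \<Longrightarrow> step3 w (p @ [(i2, a2), (i1, a1)] @ p')"

definition leads :: "('m letter list \<Rightarrow> 'm letter list \<Rightarrow> bool) \<Rightarrow> 'm pword rel" where
  "leads s = {(x, y) \<in> all_pwords \<times> all_pwords. fst x = fst y \<and> s (snd x) (snd y)}"

definition below :: "('m letter list \<Rightarrow> 'm letter list \<Rightarrow> bool) \<Rightarrow> 'm pword rel" where
  "below s = (leads s)\<^sup>* \<inter> all_pwords \<times> all_pwords"

definition maximal :: "('m letter list \<Rightarrow> 'm letter list \<Rightarrow> bool) \<Rightarrow> 'm pword \<Rightarrow> bool" where
  "maximal s x \<longleftrightarrow> x \<in> all_pwords \<and> (\<forall>y. (x, y) \<in> below s \<longrightarrow> y = x)"

definition down :: "('m letter list \<Rightarrow> 'm letter list \<Rightarrow> bool) \<Rightarrow> 'm pword \<Rightarrow> 'm pword" where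
  "down s x = (THE y. (x, y) \<in> below s \<and> maximal s y)"

definition pillars :: "nat \<Rightarrow> ('m::linorder) pword set" where
  "pillars n = {x \<in> pwords n. maximal step1 x \<and> maximal step2 x \<and> maximal step3 x}"

definition is_P_symbol :: "'m pword rel \<Rightarrow> ('m pword \<Rightarrow> 'm pword) \<Rightarrow> bool" where
  "is_P_symbol R f \<longleftrightarrow>
     equiv all_pwords R \<and>
     f \<in> all_pwords \<rightarrow> all_pwords \<and>
     (\<forall>x\<in>all_pwords. (x, f x) \<in> R) \<and>
     (\<forall>x\<in>all_pwords. \<forall>y\<in>all_pwords. (x, y) \<in> R \<longrightarrow> f x = f y)"

definition pill_equiv :: "'m pword rel" where
  "pill_equiv = {(x, y) \<in> all_pwords \<times> all_pwords.
     fst x = fst y \<and>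
     first_left (snd x) = first_left (snd y) \<and>
     mset (snd x) = mset (snd y) \<and>
     first_right (snd x) = first_right (snd y)}"

definition pill_symbol :: "('m::linorder) pword \<Rightarrow> 'm pword" where
  "pill_symbol = down step3 \<circ> down step2 \<circ> down step1"

text \<open>The equivalence preserves arities, so the quotient is graded by the arity of
  representatives.\<close>

definition Pill11 :: "nat \<Rightarrow> 'm pword set set" where
  "Pill11 n = pwords n // pill_equiv"

definition graded_iso :: "(nat \<Rightarrow> 'a set) \<Rightarrow> (nat \<Rightarrow> 'b set) \<Rightarrow> bool" where
  "graded_iso A B \<longleftrightarrow> (\<exists>f. \<forall>n. bij_betw (f n) (A n) (B n))"

end

theory Submission
  imports Defs
begin

text \<open>Each of the three relations terminates, permutes the letters and preserves both subwords of
  witnesses. A word that is maximal for the first two relations is determined by its class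
  together with its word of values: for every value the letters other than the first and
  the last one form a contiguous block, hence are sorted. For two equivalent pillars the words of
  values agree as well, as one sees at the first place where they differ: a letter that is no
  witness contradicts maximality for the first relation, a letter that is only a right witness
  contradicts maximality for the third, and two left witnesses agree by hypothesis.\<close>

section \<open>Words of values\<close>

text \<open>Instances: \<open>f = fst\<close> on letters, the identity on words of values. The set
  \<open>S\<close> holds the values met before the current suffix.\<close>

fun left_firsts :: "('a \<Rightarrow> 'b) \<Rightarrow> 'b set \<Rightarrow> 'a list \<Rightarrow> 'a list" where
  "left_firsts f S [] = []"
| "left_firsts f S (x # s) = (if f x \<in> S then [] else [x]) @ left_firsts f (insert (f x) S) s"

fun right_firsts :: "('a \<Rightarrow> 'b) \<Rightarrow> 'a list \<Rightarrow> 'a list" where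
  "right_firsts f [] = []"
| "right_firsts f (x # s) = (if f x \<in> f ` set s then [] else [x]) @ right_firsts f s"

text \<open>The subword of the positions that are left or right witnesses, \<open>S\<close> holding
  the earlier letters. A step of the first relation moves a letter that is neither, so this subword
  survives it.\<close>

fun witnesses :: "'a set \<Rightarrow> 'a list \<Rightarrow> 'a list" where
  "witnesses S [] = []"
| "witnesses S (x # s) = (if x \<in> S \<and> x \<in> set s then [] else [x]) @ witnesses (insert x S) s"

text \<open>Maximality for the first and the third relation, read off from the word of values.\<close>

definition grouped :: "'a list \<Rightarrow> bool" where
  "grouped v \<longleftrightarrow> (\<forall>p z s i. v = p @ z # s \<longrightarrow> i \<noteq> z \<longrightarrow> i \<in> set p \<longrightarrow> count_list s i \<le> 1)"

definition settled :: "'a list \<Rightarrow> bool" where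
  "settled v \<longleftrightarrow> (\<forall>p x y s. v = p @ x # y # s \<longrightarrow> x \<noteq> y \<longrightarrow> x \<in> set s \<longrightarrow> y \<in> set p \<longrightarrow> y \<in> set s)"

lemma groupedD: "\<lbrakk>grouped v; v = p @ z # s; i \<noteq> z; i \<in> set p\<rbrakk> \<Longrightarrow> count_list s i \<le> 1"
  unfolding grouped_def by blast

lemma settledD:
  "\<lbrakk>settled v; v = p @ x # y # s; x \<noteq> y; x \<in> set s; y \<in> set p\<rbrakk> \<Longrightarrow> y \<in> set s"
  unfolding settled_def by blast

lemma left_firsts_append:
  "left_firsts f S (p @ t) = left_firsts f S p @ left_firsts f (S \<union> f ` set p) t"
  by (induction p arbitrary: S) auto

text \<open>Whether a letter of \<open>p\<close> is a right witness depends on what follows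
  \<open>p\<close> only through its set of values.\<close>

lemma right_firsts_append_cong:
  "f ` set t = f ` set t' \<Longrightarrow>
    right_firsts f (p @ t) = right_firsts f (p @ t') \<longleftrightarrow> right_firsts f t = right_firsts f t'"
  by (induction p) (auto simp: image_Un)

lemma map_left_firsts: "map f (left_firsts f S w) = left_firsts (\<lambda>x. x) S (map f w)"
  by (induction w arbitrary: S) auto

lemma map_right_firsts: "map f (right_firsts f w) = right_firsts (\<lambda>x. x) (map f w)"
  by (induction w) auto

lemma witnesses_append_cong:
  "set t = set t' \<Longrightarrow>
    witnesses S (p @ t) = witnesses S (p @ t') \<longleftrightarrow>
    witnesses (S \<union> set p) t = witnesses (S \<union> set p) t'"
  by (induction p arbitrary: S) auto

section \<open>Comparison of two words at their first difference\<close>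

lemma count_list_mset_cong: "mset v = mset v' \<Longrightarrow> count_list v x = count_list v' x"
  by (simp flip: count_mset)

text \<open>Here \<open>p\<close> is a common prefix, followed by \<open>x\<close> in one word and
  by \<open>y\<close> in the other. If they differed, \<open>t\<close> would hold all the
  occurrences of \<open>x\<close> in \<open>x # s\<close>, at least two, cut off by \<open>y\<close>
  from the one in \<open>p\<close>.\<close>

lemma grouped_same_nonwitness:
  assumes "grouped (p @ y # t)" "mset (x # s) = mset (y # t)" "x \<in> set p" "x \<in> set s"
  shows "x = y"
proof (rule ccontr)
  assume ne: "x \<noteq> y"
  have "count_list (x # s) x = count_list (y # t) x"
    using assms(2) by (rule count_list_mset_cong)
  moreover have "count_list s x \<noteq> 0"
    using assms(4) by (simp add: count_list_0_iff)
  ultimately have "2 \<le> count_list t x"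
    using ne by simp
  then show False
    using groupedD[OF assms(1) refl ne assms(3)] by simp
qed

text \<open>At the first difference neither letter can have copies on both sides, so each heads its
  list of remaining witnesses, and these lists are equal.\<close>

lemma grouped_eq_if_witnesses_eq:
  assumes "grouped v" "grouped v'" "mset v = mset v'" "witnesses {} v = witnesses {} v'"
  shows "v = v'"
proof (rule ccontr)
  assume "v \<noteq> v'"
  then obtain p x s y t where v: "v = p @ x # s" and v': "v' = p @ y # t" and ne: "x \<noteq> y"
    using same_length_different[of v v'] mset_eq_length[OF assms(3)] by force
  have m: "mset (x # s) = mset (y # t)"
    using assms(3) unfolding v v' by simp
  have "witnesses (set p) (x # s) = witnesses (set p) (y # t)"
    using assms(4) witnesses_append_cong[OF mset_eq_setD[OF m], of "{}" p] unfolding v v' by simp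
  moreover have "\<not> (x \<in> set p \<and> x \<in> set s)"
    using grouped_same_nonwitness[OF assms(2)[unfolded v'] m] ne by blast
  moreover have "\<not> (y \<in> set p \<and> y \<in> set t)"
    using grouped_same_nonwitness[OF assms(1)[unfolded v] m[symmetric]] ne by blast
  ultimately show False
    using ne by simp
qed

text \<open>No letter of \<open>u\<close> in front of \<open>x\<close> is a right witness. The last
  of them would stand just before \<open>x\<close> and recur behind it, which is the pattern that
  \<open>settled\<close> forbids.\<close>

lemma settled_next_right_first:
  assumes "settled (p @ u)" "right_firsts (\<lambda>x. x) u = x # r" "x \<in> set p" "count_list u x \<le> 1"
  shows "hd u = x"
  using assms
proof (induction u arbitrary: p)
  case (Cons a u)
  show ?case
  proof (rule ccontr)
    assume "hd (a # u) \<noteq> x"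
    then have ax: "a \<noteq> x"
      by simp
    then have au: "a \<in> set u" and rf: "right_firsts (\<lambda>x. x) u = x # r"
      using Cons.prems(2) by (auto split: if_splits)
    have "hd u = x"
      using Cons.IH[of "p @ [a]"] Cons.prems rf ax by simp
    \<comment> \<open>\<open>au\<close> rules out the empty word, on which \<open>hd\<close> has no
      specified value.\<close>
    then obtain w where u: "u = x # w"
      using au by (cases u) auto
    have "x \<notin> set w"
      using Cons.prems(4) ax unfolding u by (simp add: count_list_0_iff)
    moreover have "a \<in> set w"
      using au ax unfolding u by simp
    ultimately show False
      using settledD[of "p @ a # u" p a x w] Cons.prems(1,3) ax unfolding u by blast
  qed
qed simp

text \<open>As \<open>x\<close> does not recur in \<open>s\<close>, it occurs once in
  \<open>y # t\<close> and is the next right witness there; the preceding lemma puts it in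
  front.\<close>

lemma settled_same_right_witness:
  assumes "settled (p @ y # t)" "mset (x # s) = mset (y # t)"
    "right_firsts (\<lambda>x. x) (x # s) = right_firsts (\<lambda>x. x) (y # t)" "x \<in> set p" "x \<notin> set s"
  shows "x = y"
proof -
  have "count_list (y # t) x = count_list (x # s) x"
    using assms(2) by (metis count_list_mset_cong)
  also have "\<dots> \<le> 1"
    using assms(5) by (simp add: count_list_0_iff)
  finally have "count_list (y # t) x \<le> 1" .
  moreover have "right_firsts (\<lambda>x. x) (y # t) = x # right_firsts (\<lambda>x. x) s"
    using assms(3,5) by simp
  ultimately show ?thesis
    using settled_next_right_first[OF assms(1)] assms(4) by fastforce
qed

lemma pillar_values_unique:
  assumes "grouped v" "grouped v'" "settled v" "settled v'" "mset v = mset v'"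
    "left_firsts (\<lambda>x. x) {} v = left_firsts (\<lambda>x. x) {} v'" "right_firsts (\<lambda>x. x) v = right_firsts (\<lambda>x. x) v'"
  shows "v = v'"
proof (rule ccontr)
  assume "v \<noteq> v'"
  then obtain p x s y t where v: "v = p @ x # s" and v': "v' = p @ y # t" and ne: "x \<noteq> y"
    using same_length_different[of v v'] mset_eq_length[OF assms(5)] by force
  have m: "mset (x # s) = mset (y # t)"
    using assms(5) unfolding v v' by simp
  have r: "right_firsts (\<lambda>x. x) (x # s) = right_firsts (\<lambda>x. x) (y # t)"
    using assms(7) right_firsts_append_cong[of "\<lambda>x. x" "x # s" "y # t" p] mset_eq_setD[OF m]
    unfolding v v' by simp
  have l: "left_firsts (\<lambda>x. x) (set p) (x # s) = left_firsts (\<lambda>x. x) (set p) (y # t)"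
    using assms(6) unfolding v v' left_firsts_append by simp
  have "x \<notin> set p"
    using grouped_same_nonwitness[OF assms(2)[unfolded v'] m]
      settled_same_right_witness[OF assms(4)[unfolded v'] m r] ne by blast
  moreover have "y \<notin> set p"
    using grouped_same_nonwitness[OF assms(1)[unfolded v] m[symmetric]]
      settled_same_right_witness[OF assms(3)[unfolded v] m[symmetric] r[symmetric]] ne by blast
  \<comment> \<open>Both letters are new after \<open>p\<close>, so they head the two sides of
    \<open>l\<close>.\<close>
  ultimately show False
    using l ne by simp
qed

text \<open>The third relation breaks \<^const>\<open>grouped\<close> on the way to a maximal word, since right witnesses
  traverse the blocks. The following weakening is invariant.\<close>

definition weakly_grouped :: "'a list \<Rightarrow> bool" where
  "weakly_grouped v \<longleftrightarrow> (\<forall>p z s i. v = p @ z # s \<longrightarrow> i \<noteq> z \<longrightarrow> i \<in> set p \<longrightarrow> 2 \<le> count_list s i \<longrightarrow>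
    z \<in> set p \<and> z \<notin> set s)"

lemma weakly_groupedD:
  "\<lbrakk>weakly_grouped v; v = p @ z # s; i \<noteq> z; i \<in> set p; 2 \<le> count_list s i\<rbrakk> \<Longrightarrow>
    z \<in> set p \<and> z \<notin> set s"
  unfolding weakly_grouped_def by blast

lemma grouped_imp_weakly_grouped: "grouped v \<Longrightarrow> weakly_grouped v"
  unfolding grouped_def weakly_grouped_def by fastforce

text \<open>The letter \<open>y\<close> satisfies the conclusion by itself at its new place. At
  \<open>x\<close> no \<open>i\<close> qualifies: it would have qualified in the old word, although
  \<open>x\<close> recurs in \<open>r\<close>. Elsewhere prefix and suffix keep their letters up to
  order.\<close>

lemma weakly_grouped_swap:
  assumes J: "weakly_grouped (p @ x # y # r)"
    and "x \<noteq> y" "x \<in> set r" "y \<in> set p" "y \<notin> set r"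
  shows "weakly_grouped (p @ y # x # r)"
  unfolding weakly_grouped_def
proof (intro allI impI)
  fix p1 z s i
  assume eq: "p @ y # x # r = p1 @ z # s" and iz: "i \<noteq> z" and ip: "i \<in> set p1"
    and c: "2 \<le> count_list s i"
  consider (p) q where "p = p1 @ z # q" "s = q @ y # x # r"
    | (y) "p1 = p" "z = y" "s = x # r"
    | (x) "p1 = p @ [y]" "z = x" "s = r"
    | (r) q where "p1 = p @ y # x # q" "r = q @ z # s"
    using eq by (auto simp: append_eq_append_conv2 append_eq_Cons_conv Cons_eq_append_conv)
  then show "z \<in> set p1 \<and> z \<notin> set s"
  proof cases
    case p
    have "2 \<le> count_list (q @ x # y # r) i"
      using c unfolding p(2) by (simp split: if_splits)
    then show ?thesis
      using weakly_groupedD[OF J _ iz ip, of "q @ x # y # r"] p by auto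
  next
    case y
    then show ?thesis
      using assms by simp
  next
    case x
    have "i \<noteq> y"
    proof
      assume "i = y"
      then have "count_list s i = 0"
        using assms(5) x by (simp add: count_list_0_iff)
      then show False
        using c by simp
    qed
    then show ?thesis
      using weakly_groupedD[OF J refl, of i] x iz ip c assms(3) by simp
  next
    case r
    then show ?thesis
      using weakly_groupedD[OF J, of "p @ x # y # q" z s i] iz ip c by auto
  qed
qed

text \<open>Suppose \<open>z\<close> separates an \<open>i\<close> from two later ones. Then
  \<open>z\<close> is only a right witness. The letter just before \<open>z\<close> is either an
  \<open>i\<close>, where \<open>settled\<close> fails, or it separates in the same way, with a
  shorter prefix.\<close>

lemma weakly_grouped_settled_imp_grouped:
  assumes "weakly_grouped v" "settled v"
  shows "grouped v"
proof -
  have "count_list s i \<le> 1" if "v = p @ z # s" "i \<noteq> z" "i \<in> set p" for p z s i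
    using that
  proof (induction p arbitrary: z s rule: rev_induct)
    case (snoc t p)
    show ?case
    proof (rule ccontr)
      assume "\<not> ?case"
      then have c: "2 \<le> count_list s i"
        by simp
      have z: "z \<in> set (p @ [t])" "z \<notin> set s"
        using weakly_groupedD[OF assms(1) snoc.prems c] by auto
      show False
      proof (cases "t = i")
        case True
        have "i \<in> set s"
          using c count_list_0_iff[of s i] by auto
        then show False
          using settledD[OF assms(2), of p i z s] snoc.prems z True by auto
      next
        case False
        then show False
          using snoc.IH[of t "z # s"] snoc.prems c by auto
      qed
    qed
  qed simp
  then show ?thesis
    unfolding grouped_def by blast
qed

section \<open>The three relations on words\<close>

text \<open>Maximality on bare words, without arity; \<open>maximal_iff\<close> makes the
  link.\<close>

definition normal :: "('a \<Rightarrow> 'a \<Rightarrow> bool) \<Rightarrow> 'a \<Rightarrow> bool" where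
  "normal s w \<longleftrightarrow> (\<forall>w'. \<not> s w w')"

lemma left_witness_append:
  "left_witness (p @ x # s) (length p) \<longleftrightarrow> fst x \<notin> fst ` set p"
  unfolding set_map[symmetric] in_set_conv_nth by (auto simp: left_witness_def nth_append)

lemma right_witness_append:
  "right_witness (p @ x # s) (length p) \<longleftrightarrow> fst x \<notin> fst ` set s"
proof -
  have "right_witness (p @ x # s) (length p) \<longleftrightarrow> (\<forall>k<length s. fst (s ! k) \<noteq> fst x)"
  proof
    assume *: "right_witness (p @ x # s) (length p)"
    show "\<forall>k<length s. fst (s ! k) \<noteq> fst x"
    proof (intro allI impI)
      fix k assume "k < length s"
      then show "fst (s ! k) \<noteq> fst x"
        using *[unfolded right_witness_def, THEN conjunct2, rule_format, of "length p + Suc k"]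
        by (simp add: nth_append)
    qed
  next
    assume "\<forall>k<length s. fst (s ! k) \<noteq> fst x"
    then show "right_witness (p @ x # s) (length p)"
      by (auto simp: right_witness_def nth_append nth_Cons split: nat.splits)
  qed
  then show ?thesis
    unfolding set_map[symmetric] in_set_conv_nth by auto
qed

text \<open>The two displayed letters of value \<open>i\<close> see each other, so the conditions on
  witnesses come down to another \<open>i\<close> in \<open>r\<close>.\<close>

lemma step1_iff:
  "step1 w w' \<longleftrightarrow> (\<exists>p i a b q r. w = p @ (i, a) # q @ (i, b) # r \<and>
     w' = p @ (i, a) # (i, b) # q @ r \<and> q \<noteq> [] \<and> i \<notin> fst ` set q \<and> i \<in> fst ` set r)"
proof -
  have R1: "right_witness (p @ (i, a) # q @ (i, b) # r) (length p) \<longleftrightarrow> False"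
    for p q r :: "'a letter list" and i a b
    by (simp add: right_witness_append)
  have L2: "left_witness (p @ (i, a) # q @ (i, b) # r) (Suc (length p + length q)) \<longleftrightarrow> False"
    for p q r :: "'a letter list" and i a b
    using left_witness_append[of "p @ (i, a) # q" "(i, b)" r] by simp
  have R2: "right_witness (p @ (i, a) # q @ (i, b) # r) (Suc (length p + length q)) \<longleftrightarrow>
      i \<notin> fst ` set r"
    for p q r :: "'a letter list" and i a b
    using right_witness_append[of "p @ (i, a) # q" "(i, b)" r] by simp
  have D: "(\<forall>x\<in>set q. fst x \<noteq> i) \<longleftrightarrow> i \<notin> fst ` set q" for q :: "'a letter list" and i
    by auto
  show ?thesis
    unfolding step1.simps D by (simp add: R1 L2 R2 cong: conj_cong) blast
qed

lemma step2_iff: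
  "step2 w w' \<longleftrightarrow> (\<exists>p i a b r. w = p @ (i, a) # (i, b) # r \<and> w' = p @ (i, b) # (i, a) # r \<and>
     i \<in> fst ` set p \<and> i \<in> fst ` set r \<and> b < a)"
proof -
  have L2: "left_witness (p @ (i, a) # (i, b) # r) (Suc (length p)) \<longleftrightarrow> False"
    for p r :: "'a letter list" and i a b
    using left_witness_append[of "p @ [(i, a)]" "(i, b)" r] by simp
  have R2: "right_witness (p @ (i, a) # (i, b) # r) (Suc (length p)) \<longleftrightarrow> i \<notin> fst ` set r"
    for p r :: "'a letter list" and i a b
    using right_witness_append[of "p @ [(i, a)]" "(i, b)" r] by simp
  show ?thesis
    unfolding step2.simps
    by (simp add: L2 R2 left_witness_append right_witness_append order_less_le cong: conj_cong)
      blast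
qed

text \<open>As the two values differ, the value of \<open>x\<close> must recur in \<open>r\<close>
  and that of \<open>y\<close> must occur already in \<open>p\<close>.\<close>

lemma step3_iff:
  "step3 w w' \<longleftrightarrow> (\<exists>p x y r. w = p @ x # y # r \<and> w' = p @ y # x # r \<and> fst x \<noteq> fst y \<and>
     fst x \<in> fst ` set r \<and> fst y \<in> fst ` set p \<and> fst y \<notin> fst ` set r)"
proof -
  have L2: "left_witness (p @ x # y # r) (Suc (length p)) \<longleftrightarrow> fst y \<notin> fst ` set (p @ [x])"
    for p r :: "'a letter list" and x y
    using left_witness_append[of "p @ [x]" y r] by simp
  have R2: "right_witness (p @ x # y # r) (Suc (length p)) \<longleftrightarrow> fst y \<notin> fst ` set r"
    for p r :: "'a letter list" and x y
    using right_witness_append[of "p @ [x]" y r] by simp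
  show ?thesis
    unfolding step3.simps
    by (simp add: L2 R2 right_witness_append cong: conj_cong) metis
qed

lemma step1E:
  assumes "step1 w w'"
  obtains p i a b q r where "w = p @ (i, a) # q @ (i, b) # r" "w' = p @ (i, a) # (i, b) # q @ r"
    "q \<noteq> []" "i \<notin> fst ` set q" "i \<in> fst ` set r"
  using assms unfolding step1_iff by blast

lemma step2E:
  assumes "step2 w w'"
  obtains p i a b r where "w = p @ (i, a) # (i, b) # r" "w' = p @ (i, b) # (i, a) # r"
    "i \<in> fst ` set p" "i \<in> fst ` set r" "b < a"
  using assms unfolding step2_iff by blast

lemma step3E:
  assumes "step3 w w'"
  obtains p x y r where "w = p @ x # y # r" "w' = p @ y # x # r" "fst x \<noteq> fst y"
    "fst x \<in> fst ` set r" "fst y \<in> fst ` set p" "fst y \<notin> fst ` set r"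
  using assms unfolding step3_iff by blast

section \<open>The subwords of witnesses by recursion\<close>

lemma first_right_Cons:
  "first_right (x # w) = (if fst x \<in> fst ` set w then [] else [x]) @ first_right w"
proof -
  have "right_witness (x # w) (Suc j) \<longleftrightarrow> right_witness w j" for j
  proof
    assume *: "right_witness (x # w) (Suc j)"
    show "right_witness w j"
      unfolding right_witness_def
    proof (intro conjI allI impI)
      show "j < length w"
        using * by (simp add: right_witness_def)
      fix k assume "j < k \<and> k < length w"
      then show "fst (w ! k) \<noteq> fst (w ! j)"
        using *[unfolded right_witness_def, THEN conjunct2, rule_format, of "Suc k"] by simp
    qed
  next
    assume "right_witness w j"
    then show "right_witness (x # w) (Suc j)"
      by (auto simp: right_witness_def nth_Cons split: nat.splits)
  qed
  then show ?thesis
    using right_witness_append[of "[]" x w] by (simp add: first_right_def nths_Cons)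
qed

text \<open>A left witness of the tail may repeat the value of the head. The set \<open>S\<close> of
  forbidden values makes the statement recursive, in step with \<open>left_firsts\<close>.\<close>

lemma nths_left_witness:
  "nths (x # w) {j. left_witness (x # w) j \<and> fst ((x # w) ! j) \<notin> S} =
    (if fst x \<in> S then [] else [x]) @
    nths w {j. left_witness w j \<and> fst (w ! j) \<notin> insert (fst x) S}"
proof -
  have "left_witness (x # w) (Suc j) \<longleftrightarrow> left_witness w j \<and> fst (w ! j) \<noteq> fst x" for j
    by (auto simp: left_witness_def less_Suc_eq_0_disj)
  then show ?thesis
    using left_witness_append[of "[]" x w] by (simp add: nths_Cons conj_ac)
qed

lemma first_right_eq: "first_right w = right_firsts fst w"
  by (induction w) (simp_all add: first_right_Cons, simp add: first_right_def)

lemma first_left_eq: "first_left w = left_firsts fst {} w"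
proof -
  have "nths w {j. left_witness w j \<and> fst (w ! j) \<notin> S} = left_firsts fst S w" for S
  proof (induction w arbitrary: S)
    case (Cons x w)
    show ?case
      by (simp add: nths_left_witness Cons.IH del: insert_iff)
  qed simp
  from this[of "{}"] show ?thesis
    by (simp add: first_left_def)
qed

section \<open>Invariants of single steps\<close>

lemma step_mset:
  "step1 w w' \<Longrightarrow> mset w = mset w'" "step2 v v' \<Longrightarrow> mset v = mset v'"
  "step3 u u' \<Longrightarrow> mset u = mset u'"
  by (auto elim!: step1E step2E step3E)

lemma step1_first_left: "step1 w w' \<Longrightarrow> first_left w = first_left w'"
  by (erule step1E) (simp add: first_left_eq left_firsts_append insert_commute insert_absorb)

lemma step2_first_left: "step2 w w' \<Longrightarrow> first_left w = first_left w'"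
  by (erule step2E) (simp add: first_left_eq left_firsts_append insert_commute insert_absorb)

lemma step3_first_left: "step3 w w' \<Longrightarrow> first_left w = first_left w'"
  by (erule step3E) (simp add: first_left_eq left_firsts_append insert_commute insert_absorb)

lemma step1_first_right:
  assumes "step1 w w'"
  shows "first_right w = first_right w'"
proof -
  obtain p i a b q r where w: "w = p @ (i, a) # q @ (i, b) # r" "w' = p @ (i, a) # (i, b) # q @ r"
    and r: "i \<in> fst ` set r"
    using assms by (elim step1E) simp
  have "right_firsts fst (q @ (i, b) # r) = right_firsts fst (q @ r)"
    using r by (subst right_firsts_append_cong) auto
  then show ?thesis
    unfolding w first_right_eq using r by (subst right_firsts_append_cong) auto
qed

lemma step2_first_right:
  assumes "step2 w w'"
  shows "first_right w = first_right w'"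
proof -
  obtain p i a b r where w: "w = p @ (i, a) # (i, b) # r" "w' = p @ (i, b) # (i, a) # r"
    and r: "i \<in> fst ` set r"
    using assms by (elim step2E) simp
  then show ?thesis
    unfolding w first_right_eq by (subst right_firsts_append_cong) auto
qed

lemma step3_first_right:
  assumes "step3 w w'"
  shows "first_right w = first_right w'"
proof -
  obtain p x y r where w: "w = p @ x # y # r" "w' = p @ y # x # r"
    and r: "fst x \<in> fst ` set r"
    using assms by (elim step3E) simp
  then show ?thesis
    unfolding w first_right_eq by (subst right_firsts_append_cong) auto
qed

text \<open>The moved letter has its value both before and after it, at its old place and at its new
  one, so \<open>witnesses\<close> skips it in either word.\<close>

lemma step1_witnesses:
  assumes "step1 w w'"
  shows "witnesses {} (map fst w) = witnesses {} (map fst w')"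
proof -
  obtain p i a b q r where w: "w = p @ (i, a) # q @ (i, b) # r" "w' = p @ (i, a) # (i, b) # q @ r"
    and r: "i \<in> set (map fst r)"
    using assms by (elim step1E) simp
  have "witnesses (insert i S) (map fst q @ i # map fst r) =
      witnesses (insert i S) (map fst q @ map fst r)" for S
    using r by (subst witnesses_append_cong) (auto simp: insert_absorb)
  then show ?thesis
    unfolding w map_append using r by (subst witnesses_append_cong) (auto simp: insert_absorb)
qed

lemma step1_filter:
  "step1 w w' \<Longrightarrow> filter (\<lambda>x. fst x = i) w = filter (\<lambda>x. fst x = i) w'"
proof (erule step1E)
  fix p j a b q r
  assume w: "w = p @ (j, a) # q @ (j, b) # r" "w' = p @ (j, a) # (j, b) # q @ r"
    and "j \<notin> fst ` set q"
  then have "filter (\<lambda>x. fst x = j) q = []"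
    by (force simp: filter_empty_conv)
  then show ?thesis
    unfolding w by auto
qed

lemma step3_filter:
  "step3 w w' \<Longrightarrow> filter (\<lambda>x. fst x = i) w = filter (\<lambda>x. fst x = i) w'"
  by (erule step3E) simp

lemma step2_map_fst: "step2 w w' \<Longrightarrow> map fst w = map fst w'"
  by (erule step2E) simp

lemma step3_weakly_grouped:
  "step3 w w' \<Longrightarrow> weakly_grouped (map fst w) \<Longrightarrow> weakly_grouped (map fst w')"
  by (erule step3E) (simp add: weakly_grouped_swap)

section \<open>Termination\<close>

text \<open>Moving a letter to the left may separate it from an equal value that followed it; weighting
  each gap between consecutive equal values by the number of later occurrences compensates this.\<close>

fun measure1 :: "'a list \<Rightarrow> nat" where
  "measure1 [] = 0"
| "measure1 (x # s) = (if s \<noteq> [] \<and> hd s = x then 0 else count_list s x) + measure1 s"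

text \<open>Inversions of the pigments, counted over all pairs of letters whatever their
  values.\<close>

fun measure2 :: "('a \<times> 'm::linorder) list \<Rightarrow> nat" where
  "measure2 [] = 0"
| "measure2 (x # s) = length (filter (\<lambda>y. snd y < snd x) s) + measure2 s"

text \<open>In \<open>x # s\<close> there are as many right witnesses in \<open>s\<close> as values, so this counts the pairs of
  a letter that is no right witness and a right witness after it.\<close>

fun measure3 :: "'a list \<Rightarrow> nat" where
  "measure3 [] = 0"
| "measure3 (x # s) = (if x \<in> set s then card (set s) else 0) + measure3 s"

text \<open>Each letter of \<open>q\<close> differs from \<open>i\<close> and keeps its count of
  later copies; removing the \<open>i\<close> can only bring equal letters together.\<close>

lemma measure1_remove: "i \<notin> set q \<Longrightarrow> measure1 (q @ s) \<le> measure1 (q @ i # s)"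
  by (induction q) (auto simp: hd_append)

text \<open>The shared head \<open>z\<close> gives the last letter of \<open>p\<close> the same
  successor on both sides.\<close>

lemma measure1_append:
  "\<lbrakk>mset s = mset t; measure1 (z # s) < measure1 (z # t)\<rbrakk> \<Longrightarrow>
    measure1 (p @ z # s) < measure1 (p @ z # t)"
proof (induction p)
  case (Cons x p)
  then show ?case
    using count_list_mset_cong[OF Cons.prems(1), of x] by (auto simp: hd_append)
qed simp

lemma step1_measure: "step1 w w' \<Longrightarrow> measure1 (map fst w') < measure1 (map fst w)"
proof -
  assume "step1 w w'"
  then obtain p i a b q r where w: "w = p @ (i, a) # q @ (i, b) # r"
      "w' = p @ (i, a) # (i, b) # q @ r" and q: "q \<noteq> []" "i \<notin> set (map fst q)"
    by (elim step1E) simp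
  obtain z q' where zq: "q = z # q'"
    using q(1) by (cases q) auto
  \<comment> \<open>If \<open>r\<close> holds \<open>c\<close> copies of \<open>i\<close>, the first
    \<open>i\<close> weighs \<open>c + 1\<close> before the step; afterwards the first weighs 0 and
    the second \<open>c\<close>. The rest does not grow, by \<open>measure1_remove\<close>.\<close>
  have "measure1 (i # i # map fst q @ map fst r) < measure1 (i # map fst q @ i # map fst r)"
    using measure1_remove[OF q(2), of "map fst r"] q(2) unfolding zq by auto
  then show ?thesis
    using measure1_append[of "i # map fst q @ map fst r" "map fst q @ i # map fst r" i "map fst p"]
    unfolding w by simp
qed

lemma measure2_append:
  "\<lbrakk>mset s = mset t; measure2 s < measure2 t\<rbrakk> \<Longrightarrow> measure2 (p @ s) < measure2 (p @ t)"
proof (induction p)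
  case (Cons x p)
  have "length (filter P s) = length (filter P t)" for P
    using Cons.prems(1) by (metis mset_filter size_mset)
  then show ?case
    using Cons by simp
qed simp

lemma step2_measure: "step2 w w' \<Longrightarrow> measure2 w' < measure2 w"
  by (erule step2E) (auto intro!: measure2_append)

lemma measure3_append:
  "\<lbrakk>set s = set t; measure3 s < measure3 t\<rbrakk> \<Longrightarrow> measure3 (p @ s) < measure3 (p @ t)"
  by (induction p) auto

lemma step3_measure: "step3 w w' \<Longrightarrow> measure3 (map fst w') < measure3 (map fst w)"
  by (erule step3E) (simp, rule measure3_append, auto)

lemma ex_normal:
  assumes "\<And>w w'. s w w' \<Longrightarrow> m w' < (m w :: nat)"
  shows "\<exists>w'. s\<^sup>*\<^sup>* w w' \<and> normal s w'"
proof (induction "m w" arbitrary: w rule: less_induct)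
  case less
  show ?case
  proof (cases "normal s w")
    case False
    then obtain v where v: "s w v"
      by (auto simp: normal_def)
    from less[OF assms[OF v]] show ?thesis
      by (meson v converse_rtranclp_into_rtranclp)
  qed auto
qed

lemma rtranclp_invariant: "\<lbrakk>s\<^sup>*\<^sup>* x y; \<And>x y. s x y \<Longrightarrow> f x = f y\<rbrakk> \<Longrightarrow> f x = f y"
  by (induction rule: rtranclp_induct) auto

section \<open>Uniqueness of normal forms\<close>

text \<open>The word of values gives the value of the head, and the head is then the first letter of
  the filter for that value.\<close>

lemma eq_if_values_eq:
  "\<lbrakk>map fst w = map fst w'; \<And>i. filter (\<lambda>x. fst x = i) w = filter (\<lambda>x. fst x = i) w'\<rbrakk> \<Longrightarrow> w = w'"
proof (induction w arbitrary: w')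
  case (Cons x w)
  then obtain y v where w': "w' = y # v" and xy: "fst x = fst y" and v: "map fst w = map fst v"
    by (cases w') auto
  have "x = y"
    using Cons.prems(2)[of "fst x"] xy unfolding w' by simp
  moreover have "filter (\<lambda>x. fst x = i) w = filter (\<lambda>x. fst x = i) v" for i
    using Cons.prems(2)[of i] \<open>x = y\<close> unfolding w' by (auto split: if_splits)
  ultimately show ?case
    using Cons.IH[OF v] unfolding w' by simp
qed simp

text \<open>A violation of \<open>grouped\<close> yields a step, from the last \<open>i\<close>
  before \<open>z\<close> and the first one after it. Conversely, the first letter of the nonempty
  \<open>q\<close> of a step plays the part of \<open>z\<close>.\<close>

lemma normal_step1_iff: "normal step1 w \<longleftrightarrow> grouped (map fst w)"
proof
  assume n: "normal step1 w"
  show "grouped (map fst w)"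
    unfolding grouped_def
  proof (intro allI impI, rule ccontr)
    fix P z S i
    assume eq: "map fst w = P @ z # S" and iz: "i \<noteq> z" and "i \<in> set P" "\<not> count_list S i \<le> 1"
    from eq obtain p y s where w: "w = p @ y # s" and P: "P = map fst p" "z = fst y" "S = map fst s"
      by (auto simp: map_eq_append_conv map_eq_Cons_conv)
    have "\<exists>x\<in>set p. fst x = i"
      using \<open>i \<in> set P\<close> P by auto
    then obtain p0 x q1 where p: "p = p0 @ x # q1" "fst x = i" "\<forall>u\<in>set q1. fst u \<noteq> i"
      by (rule split_list_last_propE)
    have "count_list S i \<noteq> 0"
      using \<open>\<not> count_list S i \<le> 1\<close> by simp
    then have "\<exists>x\<in>set s. fst x = i"
      unfolding count_list_0_iff P by auto
    then obtain q2 x' r where s: "s = q2 @ x' # r" "fst x' = i" "\<forall>u\<in>set q2. fst u \<noteq> i"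
      by (rule split_list_first_propE)
    \<comment> \<open>Of the occurrences of \<open>i\<close> in \<open>S\<close>, none lies in
      \<open>q2\<close> and \<open>x'\<close> is one, so another lies in \<open>r\<close>.\<close>
    have "i \<notin> set (map fst q2)"
      using s(3) by auto
    then have "count_list (map fst q2) i = 0"
      by (simp only: count_list_0_iff not_False_eq_True)
    then have "count_list (map fst r) i \<noteq> 0"
      using \<open>\<not> count_list S i \<le> 1\<close> s(2) unfolding P s(1) by auto
    then have "i \<in> fst ` set r"
      unfolding count_list_0_iff by simp
    moreover have "w = p0 @ (i, snd x) # (q1 @ y # q2) @ (i, snd x') # r"
      using w p(1,2) s(1,2) by (metis append.assoc append_Cons prod.collapse)
    moreover have "i \<notin> fst ` set (q1 @ y # q2)"
      using p(3) s(3) iz P by auto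
    ultimately have "step1 w (p0 @ (i, snd x) # (i, snd x') # (q1 @ y # q2) @ r)"
      unfolding step1_iff by blast
    then show False
      using n by (auto simp: normal_def)
  qed
next
  assume g: "grouped (map fst w)"
  show "normal step1 w"
    unfolding normal_def
  proof (intro allI notI)
    fix w' assume "step1 w w'"
    then obtain p i a b q r where w: "w = p @ (i, a) # q @ (i, b) # r" and q: "q \<noteq> []"
      "i \<notin> fst ` set q" and r: "i \<in> set (map fst r)"
      by (elim step1E) simp
    obtain z q' where zq: "q = z # q'"
      using q(1) by (cases q) auto
    have "count_list (map fst q' @ i # map fst r) i \<le> 1"
      using q(2) by (intro groupedD[OF g, of "map fst p @ [i]" "fst z"]) (auto simp: w zq)
    then have "count_list (map fst r) i = 0"
      by simp
    then show False
      using r by (simp only: count_list_0_iff not_True_eq_False)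
  qed
qed

lemma normal_step3_imp_settled:
  assumes "normal step3 w"
  shows "settled (map fst w)"
  unfolding settled_def
proof (intro allI impI, rule ccontr)
  fix P X Y S
  assume eq: "map fst w = P @ X # Y # S" and *: "X \<noteq> Y" "X \<in> set S" "Y \<in> set P" "Y \<notin> set S"
  from eq obtain p x y s where "w = p @ x # y # s" and
    P: "P = map fst p" "X = fst x" "Y = fst y" "S = map fst s"
    by (auto simp: map_eq_append_conv map_eq_Cons_conv)
  then have "step3 w (p @ y # x # s)"
    unfolding step3_iff using * unfolding P set_map by blast
  then show False
    using assms by (auto simp: normal_def)
qed

text \<open>Nonempty \<open>u\<close> and \<open>t\<close> exempt the first and the last letter of
  each value. The condition speaks of filters only, so it passes unchanged through steps of the
  third relation.\<close>

definition inner_sorted :: "('a \<times> 'm::linorder) list \<Rightarrow> bool" where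
  "inner_sorted w \<longleftrightarrow> (\<forall>i u b c t. filter (\<lambda>x. fst x = i) w = u @ b # c # t \<longrightarrow>
     u \<noteq> [] \<longrightarrow> t \<noteq> [] \<longrightarrow> snd b \<le> snd c)"

lemma inner_sorted_imp_normal_step2:
  assumes "inner_sorted w"
  shows "normal step2 w"
  unfolding normal_def
proof (intro allI notI)
  fix w' assume "step2 w w'"
  then obtain p i a b r where w: "w = p @ (i, a) # (i, b) # r"
    and *: "i \<in> fst ` set p" "i \<in> fst ` set r" "b < a"
    by (elim step2E) simp
  have "filter (\<lambda>x. fst x = i) w =
      filter (\<lambda>x. fst x = i) p @ (i, a) # (i, b) # filter (\<lambda>x. fst x = i) r"
    unfolding w by simp
  moreover have "filter (\<lambda>x. fst x = i) p \<noteq> []" "filter (\<lambda>x. fst x = i) r \<noteq> []"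
    using *(1,2) by (force simp: filter_empty_conv)+
  ultimately have "snd (i, a) \<le> snd (i, b)"
    using assms unfolding inner_sorted_def by blast
  then show False
    using * by simp
qed

lemma filter_eq_appendE:
  assumes "filter P w = u @ t"
  obtains p s where "w = p @ s" "filter P p = u" "filter P s = t"
proof -
  have "\<exists>p s. w = p @ s \<and> filter P p = u \<and> filter P s = t"
    using assms
  proof (induction u arbitrary: w)
    case (Cons b u)
    then obtain us vs where w: "w = us @ b # vs" "\<forall>x\<in>set us. \<not> P x" "P b" "filter P vs = u @ t"
      by (metis append_Cons filter_eq_Cons_iff)
    then obtain p s where "vs = p @ s" "filter P p = u" "filter P s = t"
      using Cons.IH by blast
    then show ?case
      using w by (intro exI[of _ "us @ b # p"] exI[of _ s]) simp
  qed fastforce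
  then show thesis
    using that by blast
qed

text \<open>Two consecutive inner letters of one value are adjacent in \<open>w\<close>, since a gap
  would admit a step of the first relation; a descent between them would then admit one of the
  second.\<close>

lemma normal_imp_inner_sorted:
  assumes n1: "normal step1 w" and n2: "normal step2 w"
  shows "inner_sorted w"
  unfolding inner_sorted_def
proof (intro allI impI, rule ccontr)
  fix i u b c t
  assume eq: "filter (\<lambda>x. fst x = i) w = u @ b # c # t" and u: "u \<noteq> []" and t: "t \<noteq> []"
    and bc: "\<not> snd b \<le> snd c"
  obtain p q r where w: "w = p @ b # q @ c # r" and q: "\<forall>x\<in>set q. fst x \<noteq> i"
    and p: "filter (\<lambda>x. fst x = i) p = u" and r: "filter (\<lambda>x. fst x = i) r = t"
    and f: "fst b = i" "fst c = i"
  proof -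
    obtain p1 w1 where 1: "w = p1 @ w1" "filter (\<lambda>x. fst x = i) p1 = u"
      "filter (\<lambda>x. fst x = i) w1 = b # c # t"
      using eq by (rule filter_eq_appendE)
    obtain p2 w2 where 2: "w1 = p2 @ b # w2" "\<forall>x\<in>set p2. fst x \<noteq> i" "fst b = i"
      "filter (\<lambda>x. fst x = i) w2 = c # t"
      using filter_eq_ConsD[OF 1(3)] by auto
    obtain q r where 3: "w2 = q @ c # r" "\<forall>x\<in>set q. fst x \<noteq> i" "fst c = i"
      "filter (\<lambda>x. fst x = i) r = t"
      using filter_eq_ConsD[OF 2(4)] by auto
    \<comment> \<open>\<open>p2\<close> holds no letter of value \<open>i\<close>, so
      \<open>p1 @ p2\<close> still filters to \<open>u\<close>.\<close>
    show thesis
      by (rule that[of "p1 @ p2" q r]) (use 1 2 3 in auto)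
  qed
  have ip: "i \<in> fst ` set p" and ir: "i \<in> fst ` set r"
    using u t p r by (force simp: filter_empty_conv)+
  have w: "w = p @ (i, snd b) # q @ (i, snd c) # r"
    using w f by (metis prod.collapse)
  have "q = []"
  proof (rule ccontr)
    assume "q \<noteq> []"
    moreover have "i \<notin> fst ` set q"
      using q by auto
    ultimately have "step1 w (p @ (i, snd b) # (i, snd c) # q @ r)"
      unfolding step1_iff using w ir by blast
    then show False
      using n1 by (auto simp: normal_def)
  qed
  then have "w = p @ (i, snd b) # (i, snd c) # r" and "snd c < snd b"
    using w bc by simp_all
  then have "step2 w (p @ (i, snd c) # (i, snd b) # r)"
    unfolding step2_iff using ip ir by blast
  then show False
    using n2 by (auto simp: normal_def)
qed

text \<open>With its counterpart for \<open>right_firsts\<close>: the subwords of witnesses record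
  the first and the last letter of each value.\<close>

lemma filter_left_firsts:
  "filter (\<lambda>x. f x = i) (left_firsts f S w) =
    (if i \<in> S then [] else take 1 (filter (\<lambda>x. f x = i) w))"
  by (induction w arbitrary: S) auto

lemma filter_right_firsts:
  "filter (\<lambda>x. f x = i) (right_firsts f w) =
    (if filter (\<lambda>x. f x = i) w = [] then [] else [last (filter (\<lambda>x. f x = i) w)])"
  by (induction w) (auto simp: filter_empty_conv)

text \<open>For each value the first and the last letter come from the subwords of witnesses, and
  the inner ones are the sorted arrangement of a known multiset.\<close>

lemma inner_sorted_filter_unique:
  assumes "inner_sorted w" "inner_sorted w'" and m: "mset w = mset w'"
    and l: "first_left w = first_left w'" and r: "first_right w = first_right w'"
  shows "filter (\<lambda>x. fst x = i) w = filter (\<lambda>x. fst x = i) w'"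
proof -
  let ?f = "filter (\<lambda>x. fst x = i) w" and ?g = "filter (\<lambda>x. fst x = i) w'"
  have mfg: "mset ?f = mset ?g"
    using m by (metis mset_filter)
  then have e: "?f = [] \<longleftrightarrow> ?g = []"
    by (metis mset_zero_iff)
  have len: "length ?f = length ?g"
    using mset_eq_length[OF mfg] .
  have hd: "take 1 ?f = take 1 ?g"
    using l filter_left_firsts[of fst i "{}"] unfolding first_left_eq by (metis empty_iff)
  have "(if ?f = [] then [] else [last ?f]) = (if ?g = [] then [] else [last ?g])"
    using r filter_right_firsts[of fst i] unfolding first_right_eq by metis
  then have last: "last ?f = last ?g"
    using e by (cases "?f = []") simp_all
  \<comment> \<open>Here \<open>k\<close> is what remains of the letters of value \<open>i\<close>
    without the first and the last.\<close>
  have inner: "sorted (map snd k)" if "inner_sorted v" "filter (\<lambda>x. fst x = i) v = a # k @ [z]" for v k a z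
    unfolding sorted_iff_nth_Suc
  proof (intro allI impI)
    fix j assume "Suc j < length (map snd k)"
    then have "k = take j k @ k ! j # k ! Suc j # drop (Suc (Suc j)) k"
      by (metis Cons_nth_drop_Suc Suc_lessD append_take_drop_id length_map)
    then have "filter (\<lambda>x. fst x = i) v =
        (a # take j k) @ k ! j # k ! Suc j # (drop (Suc (Suc j)) k @ [z])"
      using that(2) by simp
    then have "snd (k ! j) \<le> snd (k ! Suc j)"
      using that(1) unfolding inner_sorted_def by blast
    then show "map snd k ! j \<le> map snd k ! Suc j"
      using \<open>Suc j < length (map snd k)\<close> by simp
  qed
  consider "length ?f \<le> 1" | "2 \<le> length ?f"
    by linarith
  then show ?thesis
  proof cases
    case 1
    then show ?thesis
      using hd len by simp
  next
    case 2
    have split: "\<exists>a k z. h = a # k @ [z]" if "2 \<le> length h" for h :: "(nat \<times> 'a) list"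
      using that by (cases h; cases "tl h" rule: rev_cases) auto
    obtain a k z where f: "?f = a # k @ [z]"
      using split[OF 2] by blast
    obtain a' k' z' where g: "?g = a' # k' @ [z']"
      using split[of ?g] 2 len by auto
    have az: "a = a'" "z = z'"
      using hd last unfolding f g by simp_all
    have mk: "mset k = mset k'"
      using mfg unfolding f g az by simp
    have "sort (map snd k') = map snd k" "sort (map snd k') = map snd k'"
      using inner[OF assms(1) f] inner[OF assms(2) g] mk
      by (auto intro!: properties_for_sort simp: mset_map)
    then have s: "map snd k = map snd k'"
      by simp
    \<comment> \<open>All letters here have value \<open>i\<close>, so equal pigments give equal
      letters.\<close>
    have c: "h = map (Pair i) (map snd h)" if "set h \<subseteq> {x. fst x = i}" for h :: "(nat \<times> 'a) list"
      using that by (induction h) auto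
    have "set ?f \<subseteq> {x. fst x = i}" "set ?g \<subseteq> {x. fst x = i}"
      by auto
    then have "k = map (Pair i) (map snd k)" "k' = map (Pair i) (map snd k')"
      unfolding f g by (simp_all only: c set_simps set_append insert_subset Un_subset_iff)
    then have "k = k'"
      using s by metis
    then show ?thesis
      unfolding f g az by simp
  qed
qed

text \<open>The first relation preserves the multiset, the \<open>witnesses\<close> and the order
  inside each value; the first two fix the word of values of a normal form, the third its
  letters.\<close>

lemma step1_unique:
  assumes "step1\<^sup>*\<^sup>* w u" "step1\<^sup>*\<^sup>* w v" "normal step1 u" "normal step1 v"
  shows "u = v"
proof (rule eq_if_values_eq)
  have "mset u = mset v"
    using rtranclp_invariant[OF assms(1), of mset] rtranclp_invariant[OF assms(2), of mset]
      step_mset(1) by metis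
  moreover have "witnesses {} (map fst u) = witnesses {} (map fst v)"
    using rtranclp_invariant[OF assms(1), of "\<lambda>w. witnesses {} (map fst w)"]
      rtranclp_invariant[OF assms(2), of "\<lambda>w. witnesses {} (map fst w)"] step1_witnesses by metis
  ultimately show "map fst u = map fst v"
    using grouped_eq_if_witnesses_eq[of "map fst u" "map fst v"] assms(3,4)
    by (simp add: normal_step1_iff mset_map)
  show "filter (\<lambda>x. fst x = i) u = filter (\<lambda>x. fst x = i) v" for i
    using rtranclp_invariant[OF assms(1), of "filter (\<lambda>x. fst x = i)"]
      rtranclp_invariant[OF assms(2), of "filter (\<lambda>x. fst x = i)"] step1_filter by metis
qed

definition same_class :: "'m letter list \<Rightarrow> 'm letter list \<Rightarrow> bool" where
  "same_class w w' \<longleftrightarrow>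
    first_left w = first_left w' \<and> mset w = mset w' \<and> first_right w = first_right w'"

lemma same_class_rtranclp:
  assumes "s\<^sup>*\<^sup>* w w'" "\<And>w w'. s w w' \<Longrightarrow> same_class w w'"
  shows "same_class w w'"
  using assms by (induction rule: rtranclp_induct) (auto simp: same_class_def)

lemma step_same_class:
  "step1 w w' \<Longrightarrow> same_class w w'" "step2 v v' \<Longrightarrow> same_class v v'"
  "step3 u u' \<Longrightarrow> same_class u u'"
  by (simp_all add: same_class_def step_mset step1_first_left step2_first_left step3_first_left
      step1_first_right step2_first_right step3_first_right)

lemma step2_normal_step1:
  assumes "step2\<^sup>*\<^sup>* w w'" "normal step1 w"
  shows "normal step1 w'"
  using assms rtranclp_invariant[OF assms(1), of "map fst"] step2_map_fst
  unfolding normal_step1_iff by metis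

text \<open>The word of values stays fixed, hence so does maximality for the first relation, and
  both ends are \<open>inner_sorted\<close>.\<close>

lemma step2_unique:
  assumes "step2\<^sup>*\<^sup>* w u" "step2\<^sup>*\<^sup>* w v" "normal step1 w" "normal step2 u" "normal step2 v"
  shows "u = v"
proof (rule eq_if_values_eq)
  show "map fst u = map fst v"
    using rtranclp_invariant[OF assms(1), of "map fst"] rtranclp_invariant[OF assms(2), of "map fst"]
      step2_map_fst by metis
  have "same_class u v"
    using same_class_rtranclp[OF assms(1) step_same_class(2)]
      same_class_rtranclp[OF assms(2) step_same_class(2)] by (simp add: same_class_def)
  moreover have "inner_sorted u" "inner_sorted v"
    using assms by (auto intro: normal_imp_inner_sorted step2_normal_step1)
  ultimately show "filter (\<lambda>x. fst x = i) u = filter (\<lambda>x. fst x = i) v" for i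
    by (intro inner_sorted_filter_unique) (simp_all add: same_class_def)
qed

text \<open>\<open>grouped\<close> may fail midway but \<open>weakly_grouped\<close> does not, and
  at the end \<open>settled\<close> restores the former. Maximality for the second relation is
  carried by \<open>inner_sorted\<close>, which depends on the filters alone.\<close>

lemma step3_normal_step12:
  assumes st: "step3\<^sup>*\<^sup>* w w'" and n: "normal step1 w" "normal step2 w" "normal step3 w'"
  shows "normal step1 w'" "normal step2 w'"
proof -
  from st have "weakly_grouped (map fst w')"
  proof (induction rule: rtranclp_induct)
    case base
    show ?case
      using n(1) by (simp add: normal_step1_iff grouped_imp_weakly_grouped)
  qed (rule step3_weakly_grouped)
  then show "normal step1 w'"
    using n(3) unfolding normal_step1_iff
    by (intro weakly_grouped_settled_imp_grouped normal_step3_imp_settled)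
  have "filter (\<lambda>x. fst x = i) w = filter (\<lambda>x. fst x = i) w'" for i
    using rtranclp_invariant[OF st, of "filter (\<lambda>x. fst x = i)"] step3_filter by metis
  then have "inner_sorted w'"
    using normal_imp_inner_sorted[OF n(1,2)] unfolding inner_sorted_def by simp
  then show "normal step2 w'"
    by (rule inner_sorted_imp_normal_step2)
qed

lemma normal_unique:
  assumes c: "same_class u v"
    and "normal step1 u" "normal step2 u" "normal step3 u"
    and "normal step1 v" "normal step2 v" "normal step3 v"
  shows "u = v"
proof (rule eq_if_values_eq)
  show "map fst u = map fst v"
  proof (rule pillar_values_unique)
    show "mset (map fst u) = mset (map fst v)"
      using c by (simp add: same_class_def mset_map)
    show "left_firsts (\<lambda>x. x) {} (map fst u) = left_firsts (\<lambda>x. x) {} (map fst v)"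
      using c by (simp add: same_class_def first_left_eq flip: map_left_firsts)
    show "right_firsts (\<lambda>x. x) (map fst u) = right_firsts (\<lambda>x. x) (map fst v)"
      using c by (simp add: same_class_def first_right_eq flip: map_right_firsts)
  qed (use assms in \<open>simp_all add: normal_step3_imp_settled flip: normal_step1_iff\<close>)
  show "filter (\<lambda>x. fst x = i) u = filter (\<lambda>x. fst x = i) v" for i
    using assms by (intro inner_sorted_filter_unique normal_imp_inner_sorted)
      (simp_all add: same_class_def)
qed

section \<open>Graded words\<close>

lemma pwords_iff: "(n, w) \<in> pwords k \<longleftrightarrow> n = k \<and> (\<forall>x\<in>set w. 1 \<le> fst x \<and> fst x \<le> n)"
  by (auto simp: pwords_def)

lemma all_pwords_iff: "(n, w) \<in> all_pwords \<longleftrightarrow> (\<forall>x\<in>set w. 1 \<le> fst x \<and> fst x \<le> n)"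
  by (auto simp: all_pwords_def pwords_iff)

lemma pill_equiv_iff:
  "((n, w), (n', w')) \<in> pill_equiv \<longleftrightarrow> n = n' \<and> (n, w) \<in> all_pwords \<and> same_class w w'"
  by (auto simp: pill_equiv_def same_class_def all_pwords_iff dest: mset_eq_setD)

lemma equiv_pill_equiv: "equiv all_pwords pill_equiv"
  by (rule equivI) (auto simp: refl_on_def sym_def trans_def pill_equiv_def)

text \<open>The arity never changes and a permutation of the letters keeps all values within bounds,
  so paths in \<open>leads\<close> are paths of bare words.\<close>

lemma below_iff:
  assumes "\<And>w w'. s w w' \<Longrightarrow> mset w = mset w'"
  shows "((n, w), (n', w')) \<in> below s \<longleftrightarrow> n = n' \<and> (n, w) \<in> all_pwords \<and> s\<^sup>*\<^sup>* w w'"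
proof
  assume "((n, w), (n', w')) \<in> below s"
  then have "((n, w), (n', w')) \<in> (leads s)\<^sup>*" and w: "(n, w) \<in> all_pwords"
    by (auto simp: below_def)
  then have "n = n' \<and> s\<^sup>*\<^sup>* w w'"
    by (induction rule: rtrancl_induct2) (auto simp: leads_def)
  then show "n = n' \<and> (n, w) \<in> all_pwords \<and> s\<^sup>*\<^sup>* w w'"
    using w by simp
next
  assume *: "n = n' \<and> (n, w) \<in> all_pwords \<and> s\<^sup>*\<^sup>* w w'"
  then have "s\<^sup>*\<^sup>* w w'"
    by simp
  then have "((n, w), (n, w')) \<in> (leads s)\<^sup>* \<and> (n, w') \<in> all_pwords"
  proof (induction rule: rtranclp_induct)
    case base
    show ?case
      using * by blast
  next
    case (step u v)
    have "(n, v) \<in> all_pwords"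
      using step.IH mset_eq_setD[OF assms[OF step.hyps(2)]] by (simp add: all_pwords_iff)
    then show ?case
      using step by (auto simp: leads_def intro: rtrancl_into_rtrancl)
  qed
  then show "((n, w), (n', w')) \<in> below s"
    using * unfolding below_def by blast
qed

text \<open>By irreflexivity a step from \<open>w\<close> leads to a different word above it;
  conversely, without a step the closure reaches \<open>w\<close> alone.\<close>

lemma maximal_iff:
  assumes "\<And>w w'. s w w' \<Longrightarrow> mset w = mset w'" "\<And>w. \<not> s w w"
  shows "maximal s (n, w) \<longleftrightarrow> (n, w) \<in> all_pwords \<and> normal s w"
proof
  assume m: "maximal s (n, w)"
  then have w: "(n, w) \<in> all_pwords"
    by (simp add: maximal_def)
  moreover have "normal s w"
    unfolding normal_def
  proof (intro allI notI)
    fix w' assume "s w w'"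
    then have "((n, w), (n, w')) \<in> below s"
      using w below_iff[of s, OF assms(1)] by blast
    then have "w' = w"
      using m by (simp add: maximal_def)
    then show False
      using \<open>s w w'\<close> assms(2) by simp
  qed
  ultimately show "(n, w) \<in> all_pwords \<and> normal s w" ..
next
  assume *: "(n, w) \<in> all_pwords \<and> normal s w"
  have "y = (n, w)" if "((n, w), y) \<in> below s" for y
    using that * by (cases y) (auto simp: below_iff[of s, OF assms(1)] normal_def elim: converse_rtranclpE)
  then show "maximal s (n, w)"
    using * by (simp add: maximal_def)
qed

lemma step_irrefl: "\<not> step1 w w" "\<not> step2 v v" "\<not> step3 u u"
  using step1_measure step2_measure step3_measure by (meson less_irrefl)+

lemmas maximal_step_iff = maximal_iff[of step1, OF step_mset(1) step_irrefl(1)]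
  maximal_iff[of step2, OF step_mset(2) step_irrefl(2)]
  maximal_iff[of step3, OF step_mset(3) step_irrefl(3)]

text \<open>Existence and uniqueness of a reachable normal form are what the description operator in
  \<open>down\<close> asks for.\<close>

lemma down_eq:
  assumes "\<And>w w'. s w w' \<Longrightarrow> mset w = mset w'" "\<And>w. \<not> s w w"
    and "(n, w) \<in> all_pwords" "s\<^sup>*\<^sup>* w w'" "normal s w'"
    and "\<And>v. s\<^sup>*\<^sup>* w v \<Longrightarrow> normal s v \<Longrightarrow> v = w'"
  shows "down s (n, w) = (n, w') \<and> (n, w') \<in> all_pwords"
proof -
  note b = below_iff[of s, OF assms(1)] and m = maximal_iff[of s, OF assms(1,2)]
  have 1: "((n, w), (n, w')) \<in> below s"
    using assms(3,4) by (simp add: b)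
  then have 2: "(n, w') \<in> all_pwords"
    by (simp add: below_def)
  have "down s (n, w) = (n, w')"
    unfolding down_def
  proof (rule the_equality)
    show "((n, w), (n, w')) \<in> below s \<and> maximal s (n, w')"
      using 1 2 assms(5) by (simp add: m)
    show "y = (n, w')" if "((n, w), y) \<in> below s \<and> maximal s y" for y
      using that assms(6) by (cases y) (simp add: b m)
  qed
  then show ?thesis
    using 2 by simp
qed

lemma pill_symbol_normal:
  assumes w: "(n, w) \<in> all_pwords"
  shows "\<exists>w'. pill_symbol (n, w) = (n, w') \<and> (n, w') \<in> all_pwords \<and> same_class w w' \<and>
    normal step1 w' \<and> normal step2 w' \<and> normal step3 w'"
proof -
  obtain w1 where 1: "step1\<^sup>*\<^sup>* w w1" "normal step1 w1"
    using ex_normal[of step1 "\<lambda>w. measure1 (map fst w)"] step1_measure by blast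
  have d1: "down step1 (n, w) = (n, w1)" "(n, w1) \<in> all_pwords"
    using down_eq[of step1, OF step_mset(1) step_irrefl(1) w 1] step1_unique 1 by blast+
  obtain w2 where 2: "step2\<^sup>*\<^sup>* w1 w2" "normal step2 w2"
    using ex_normal[of step2 measure2] step2_measure by blast
  have d2: "down step2 (n, w1) = (n, w2)" "(n, w2) \<in> all_pwords"
    using down_eq[of step2, OF step_mset(2) step_irrefl(2) d1(2) 2] step2_unique 1 2 by blast+
  have n1: "normal step1 w2"
    using step2_normal_step1 1 2 by blast
  obtain w3 where 3: "step3\<^sup>*\<^sup>* w2 w3" "normal step3 w3"
    using ex_normal[of step3 "\<lambda>w. measure3 (map fst w)"] step3_measure by blast
  have c3: "same_class w2 v" if "step3\<^sup>*\<^sup>* w2 v" for v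
    using same_class_rtranclp[OF that step_same_class(3)] .
  \<comment> \<open>Any end of the third stage is maximal for all three relations and stays in the
    class, so its uniqueness comes from \<open>normal_unique\<close>.\<close>
  have "v = w3" if "step3\<^sup>*\<^sup>* w2 v" "normal step3 v" for v
  proof (rule normal_unique)
    show "same_class v w3"
      using c3[OF that(1)] c3[OF 3(1)] by (simp add: same_class_def)
  qed (use that 3 n1 2 step3_normal_step12 in blast)+
  then have d3: "down step3 (n, w2) = (n, w3)" "(n, w3) \<in> all_pwords"
    using down_eq[of step3, OF step_mset(3) step_irrefl(3) d2(2) 3] by blast+
  have "same_class w w3"
    using same_class_rtranclp[OF 1(1) step_same_class(1)]
      same_class_rtranclp[OF 2(1) step_same_class(2)] c3[OF 3(1)] by (simp add: same_class_def)
  moreover have "normal step1 w3" "normal step2 w3"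
    using step3_normal_step12[OF 3(1) n1 2(2) 3(2)] by auto
  ultimately show ?thesis
    using d1 d2 d3 3 by (simp add: pill_symbol_def)
qed

section \<open>Pillars as representatives of the classes\<close>

lemma pillars_iff:
  "(n, w) \<in> pillars k \<longleftrightarrow> n = k \<and> (n, w) \<in> all_pwords \<and>
    normal step1 w \<and> normal step2 w \<and> normal step3 w"
  by (auto simp: pillars_def maximal_step_iff pwords_iff all_pwords_iff)

lemma pill_symbol_pillar:
  assumes "x \<in> pwords n"
  shows "pill_symbol x \<in> pillars n" "(x, pill_symbol x) \<in> pill_equiv"
proof -
  obtain w where x: "x = (n, w)" and w: "(n, w) \<in> all_pwords"
    using assms by (cases x) (auto simp: pwords_iff all_pwords_iff)
  show "pill_symbol x \<in> pillars n" "(x, pill_symbol x) \<in> pill_equiv"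
    using pill_symbol_normal[OF w] w unfolding x by (auto simp: pillars_iff pill_equiv_iff)
qed

lemma equivalent_pillars_eq:
  assumes "x \<in> pillars n" "y \<in> pillars k" "(x, y) \<in> pill_equiv"
  shows "x = y"
  using assms by (cases x, cases y) (auto simp: pillars_iff pill_equiv_iff dest: normal_unique)

lemma pill_equiv_sym: "(x, y) \<in> pill_equiv \<Longrightarrow> (y, x) \<in> pill_equiv"
  and pill_equiv_trans: "(x, y) \<in> pill_equiv \<Longrightarrow> (y, z) \<in> pill_equiv \<Longrightarrow> (x, z) \<in> pill_equiv"
  by (auto simp: pill_equiv_def)

lemma pill_symbol_eq_iff:
  assumes "x \<in> pwords n" "y \<in> pwords k"
  shows "pill_symbol x = pill_symbol y \<longleftrightarrow> (x, y) \<in> pill_equiv"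
proof
  note x = pill_symbol_pillar[OF assms(1)] and y = pill_symbol_pillar[OF assms(2)]
  show "(x, y) \<in> pill_equiv" if "pill_symbol x = pill_symbol y"
    using pill_equiv_trans[OF x(2)] pill_equiv_sym[OF y(2)] that by simp
  show "pill_symbol x = pill_symbol y" if "(x, y) \<in> pill_equiv"
    using pill_equiv_trans[OF pill_equiv_sym[OF x(2)] pill_equiv_trans[OF that y(2)]]
    by (rule equivalent_pillars_eq[OF x(1) y(1)])
qed

lemma pill_symbol_fixes_pillar: "x \<in> pillars n \<Longrightarrow> pill_symbol x = x"
  using pill_symbol_pillar[of x n] equivalent_pillars_eq[of x n "pill_symbol x" n]
  by (simp add: pillars_def)

text \<open>Lets \<open>the_elem\<close> in the final bijection return the common pillar of a
  class.\<close>

lemma pill_symbol_image_class: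
  assumes "x \<in> pwords n"
  shows "pill_symbol ` (pill_equiv `` {x}) = {pill_symbol x}"
proof -
  have "pill_symbol y = pill_symbol x" if xy: "(x, y) \<in> pill_equiv" for y
  proof -
    obtain k where "y \<in> pwords k"
      using xy by (cases x, cases y) (auto simp: pill_equiv_def all_pwords_def)
    then show ?thesis
      using pill_symbol_eq_iff[OF assms] xy by metis
  qed
  moreover have "(x, x) \<in> pill_equiv"
    using assms by (auto simp: pill_equiv_def all_pwords_def)
  ultimately show ?thesis
    by blast
qed

theorem theorem5p3p6:
  shows "is_P_symbol pill_equiv (pill_symbol :: ('m::{monoid_mult,linorder}) pword \<Rightarrow> 'm pword)
    \<and> (pill_symbol :: 'm pword \<Rightarrow> 'm pword) ` all_pwords = (\<Union>n. pillars n)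
    \<and> graded_iso (Pill11 :: nat \<Rightarrow> 'm pword set set) (pillars :: nat \<Rightarrow> 'm pword set)"
proof (intro conjI)
  have sub: "pillars n \<subseteq> (pwords n :: 'm pword set)" for n
    by (auto simp: pillars_def)
  show "is_P_symbol pill_equiv (pill_symbol :: 'm pword \<Rightarrow> 'm pword)"
    unfolding is_P_symbol_def
  proof (intro conjI ballI impI)
    show "equiv all_pwords (pill_equiv :: 'm pword rel)"
      by (rule equiv_pill_equiv)
    show "(pill_symbol :: 'm pword \<Rightarrow> 'm pword) \<in> all_pwords \<rightarrow> all_pwords"
      using pill_symbol_pillar(1) sub unfolding all_pwords_def by blast
    show "(x, pill_symbol x) \<in> pill_equiv" if "x \<in> all_pwords" for x :: "'m pword"
      using that pill_symbol_pillar(2) unfolding all_pwords_def by blast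
    show "pill_symbol x = pill_symbol y"
      if "x \<in> all_pwords" "y \<in> all_pwords" "(x, y) \<in> pill_equiv" for x y :: "'m pword"
      using that pill_symbol_eq_iff unfolding all_pwords_def by blast
  qed
  have image: "pill_symbol ` pwords n = (pillars n :: 'm pword set)" for n
  proof
    show "pill_symbol ` pwords n \<subseteq> (pillars n :: 'm pword set)"
      using pill_symbol_pillar(1) by blast
    show "(pillars n :: 'm pword set) \<subseteq> pill_symbol ` pwords n"
    proof
      fix x :: "'m pword"
      assume x: "x \<in> pillars n"
      then have "x \<in> pwords n"
        using sub by blast
      \<comment> \<open>A pillar is its own preimage.\<close>
      then have "pill_symbol x \<in> pill_symbol ` pwords n"
        by (rule imageI)
      then show "x \<in> pill_symbol ` pwords n"
        unfolding pill_symbol_fixes_pillar[OF x] .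
    qed
  qed
  then show "(pill_symbol :: 'm pword \<Rightarrow> 'm pword) ` all_pwords = (\<Union>n. pillars n)"
    unfolding all_pwords_def image_UN by simp
  \<comment> \<open>The symbol is constant on each class, so a class is sent to its one pillar.
    Injectivity is \<open>pill_symbol_eq_iff\<close>, surjectivity the fact
    \<open>image\<close>.\<close>
  have "bij_betw (\<lambda>C. the_elem (pill_symbol ` C)) (Pill11 n) (pillars n :: 'm pword set)" for n
    unfolding bij_betw_def
  proof (intro conjI inj_onI)
    fix C D :: "'m pword set"
    assume "C \<in> Pill11 n" "D \<in> Pill11 n"
      and eq: "the_elem (pill_symbol ` C) = the_elem (pill_symbol ` D)"
    then obtain x y where x: "x \<in> pwords n" "C = pill_equiv `` {x}"
      and y: "y \<in> pwords n" "D = pill_equiv `` {y}"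
      by (auto simp: Pill11_def elim!: quotientE)
    have "(x, y) \<in> pill_equiv"
      using eq pill_symbol_eq_iff[OF x(1) y(1)] x y by (simp add: pill_symbol_image_class)
    then show "C = D"
      unfolding x y by (rule equiv_class_eq[OF equiv_pill_equiv])
  next
    have "(\<lambda>C. the_elem (pill_symbol ` C)) ` Pill11 n = pill_symbol ` (pwords n :: 'm pword set)"
      by (auto simp: Pill11_def quotient_def pill_symbol_image_class image_iff)
    then show "(\<lambda>C. the_elem (pill_symbol ` C)) ` Pill11 n = (pillars n :: 'm pword set)"
      by (simp add: image)
  qed
  then show "graded_iso (Pill11 :: nat \<Rightarrow> 'm pword set set) (pillars :: nat \<Rightarrow> 'm pword set)"
    unfolding graded_iso_def by (intro exI allI)
qed

end
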